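(* Let $\hat{\mathbf{v}}_{\mathrm{SPL}}, \hat{\mathbf{v}}_{\mathrm{SCO}} \in \mathbb{R}^d$ be unit vectors (with respect to the Euclidean norm $\|\cdot\|_2$) with cosine similarity $\rho = \langle \hat{\mathbf{v}}_{\mathrm{SPL}}, \hat{\mathbf{v}}_{\mathrm{SCO}}\rangle$. For $\alpha \in [0,1]$ let $\mathbf{v}_\alpha = (1-\alpha)\,\hat{\mathbf{v}}_{\mathrm{SPL}} + \alpha\,\hat{\mathbf{v}}_{\mathrm{SCO}}$. Then for every $\alpha \in [0,1]$, $$\|\mathbf{v}_\alpha\|_2^2 = 1 - 2\alpha(1-\alpha)(1-\rho).$$ Moreover, for any $\rho < 1$, the function $\alpha \mapsto \|\mathbf{v}_\alpha\|_2^2$ on $[0,1]$ is minimised at $\alpha^* = \tfrac{1}{2}$, where $\|\mathbf{v}_{1/2}\|_2^2 = \tfrac{1+\rho}{2}$.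
   Context: $\langle\cdot,\cdot\rangle$ is the standard inner product on $\mathbb{R}^d$ and $\|\cdot\|_2$ the associated Euclidean norm. The subscripts SPL and SCO are merely names for two given unit vectors. *)

theory Defs
  imports "HOL-Analysis.Analysis"
begin

definition v_interp :: "real ^ 'd \<Rightarrow> real ^ 'd \<Rightarrow> real \<Rightarrow> real ^ 'd" where
  "v_interp v w \<alpha> = (1 - \<alpha>) *\<^sub>R v + \<alpha> *\<^sub>R w"

end

theory Submission
  imports Defs
begin

text \<open>For unit vectors, expanding the inner product gives (1 - \<alpha>)^2 + \<alpha>^2 + 2
  \<alpha> (1 - \<alpha>) \<rho>, and (1 - \<alpha>)^2 + \<alpha>^2 = 1 - 2 \<alpha> (1 - \<alpha>)
  yields the closed form. This is a quadratic in \<alpha>; completing the square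
  (\<open>norm_v_interp_squared_vertex\<close>) puts its vertex at 1/2 with leading coefficient
  \<open>2 * (1 - \<rho>)\<close>. For \<rho> < 1 that coefficient is positive, so 1/2 is the only
  minimiser.\<close>

lemma norm_v_interp_squared:
  fixes v w :: "real ^ 'd"
  assumes "norm v = 1" and "norm w = 1"
  shows "(norm (v_interp v w \<alpha>))\<^sup>2 = 1 - 2 * \<alpha> * (1 - \<alpha>) * (1 - v \<bullet> w)"
proof -
  have "v \<bullet> v = 1" "w \<bullet> w = 1"
    using assms by (simp_all add: dot_square_norm)
  then show ?thesis
    unfolding v_interp_def power2_norm_eq_inner
    by (simp add: inner_add_left inner_add_right inner_commute[of w v] algebra_simps)
qed

text \<open>From \<alpha> (1 - \<alpha>) = 1/4 - (\<alpha> - 1/2)^2. In this form both the minimum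
  value and the strictness of the minimum can be read off.\<close>

lemma norm_v_interp_squared_vertex:
  fixes v w :: "real ^ 'd"
  assumes "norm v = 1" and "norm w = 1"
  shows "(norm (v_interp v w \<alpha>))\<^sup>2 = (1 + v \<bullet> w) / 2 + 2 * (1 - v \<bullet> w) * (\<alpha> - 1 / 2)\<^sup>2"
  unfolding norm_v_interp_squared[OF assms]
  by (simp add: power2_eq_square field_simps)

theorem proposition4p1:
  fixes v_SPL v_SCO :: "real ^ 'd" and \<rho> :: real
  assumes "norm v_SPL = 1" and "norm v_SCO = 1"
    and "\<rho> = v_SPL \<bullet> v_SCO"
  shows "(\<forall>\<alpha>\<in>{0..1}. (norm (v_interp v_SPL v_SCO \<alpha>))\<^sup>2 = 1 - 2 * \<alpha> * (1 - \<alpha>) * (1 - \<rho>)) \<and>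
    (\<rho> < 1 \<longrightarrow>
      {\<alpha>. is_arg_min (\<lambda>\<alpha>. (norm (v_interp v_SPL v_SCO \<alpha>))\<^sup>2) (\<lambda>\<alpha>. \<alpha> \<in> {0..1}) \<alpha>} = {1 / 2} \<and>
      (norm (v_interp v_SPL v_SCO (1 / 2)))\<^sup>2 = (1 + \<rho>) / 2)"
proof (intro conjI ballI impI)
  let ?f = "\<lambda>\<alpha>. (norm (v_interp v_SPL v_SCO \<alpha>))\<^sup>2"
  have vertex: "?f \<alpha> = (1 + \<rho>) / 2 + 2 * (1 - \<rho>) * (\<alpha> - 1 / 2)\<^sup>2" for \<alpha>
    using norm_v_interp_squared_vertex[OF assms(1,2)] assms(3) by simp
  show "?f \<alpha> = 1 - 2 * \<alpha> * (1 - \<alpha>) * (1 - \<rho>)" for \<alpha>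
    using norm_v_interp_squared[OF assms(1,2)] assms(3) by simp
  show half: "?f (1 / 2) = (1 + \<rho>) / 2"
    using vertex[of "1 / 2"] by simp
  assume "\<rho> < 1"
  \<comment> \<open>The excess over the value at 1/2 is a positive coefficient times a nonzero
    square; this holds on the whole real line.\<close>
  then have less: "?f (1 / 2) < ?f \<alpha>" if "\<alpha> \<noteq> 1 / 2" for \<alpha>
    unfolding half vertex[of \<alpha>] using that by simp
  then have "?f (1 / 2) \<le> ?f \<alpha>" for \<alpha>
    by (metis order.refl less_imp_le)
  then have "is_arg_min ?f (\<lambda>\<alpha>. \<alpha> \<in> {0..1}) (1 / 2)"
    unfolding is_arg_min_linorder by simp
  \<comment> \<open>Uniqueness: any other minimiser would be strictly beaten by 1/2, which itself
    lies in the interval.\<close>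
  moreover have "\<alpha> = 1 / 2" if "is_arg_min ?f (\<lambda>\<alpha>. \<alpha> \<in> {0..1}) \<alpha>" for \<alpha>
  proof (rule ccontr)
    assume "\<alpha> \<noteq> 1 / 2"
    moreover have "(1 / 2 :: real) \<in> {0..1}" by simp
    ultimately show False
      using that less[of \<alpha>] unfolding is_arg_min_def by blast
  qed
  ultimately show "{\<alpha>. is_arg_min ?f (\<lambda>\<alpha>. \<alpha> \<in> {0..1}) \<alpha>} = {1 / 2}"
    by blast
qed

end
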